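(* Let $(G,\sigma)$ be a signed graph containing no long barbells. Then $(G,\sigma)\in\mathcal{G}_1$, and consequently, if $(G,\sigma)$ is flow-admissible, $\lceil\Phi_c(G,\sigma)\rceil=\Phi_i(G,\sigma)$.
   Context: A signed graph $(G,\sigma)$ is a graph $G$ with a signature $\sigma:E(G)\to\{-1,+1\}$; edges with $\sigma(e)=-1$ are negative. A circuit is balanced if it contains an even number of negative edges and unbalanced otherwise. A long barbell is the union of two vertex-disjoint unbalanced circuits together with a path meeting the circuits only at its two ends. Each edge $e=uv$ consists of half-edges $h_e^u$ and $h_e^v$; $H(v)$ is the set of half-edges at $v$. An orientation is a map $\tau$ from half-edges to $\{\pm1\}$ with $\tau(h_e^u)\tau(h_e^v)=-\sigma(e)$. For $f:E(G)\to\mathbb{R}$, $(\tau,f)$ is a flow if $\sum_{h\in H(v)}\tau(h)f(e_h)=0$ for every vertex $v$ ($e_h$ the edge containing $h$). For real $r\ge2$, a circular $r$-flow is a flow with $1\le|f(e)|\le r-1$ for all $e$; a nowhere-zero $k$-flow is a flow with integer values and $1\le |f(e)|\le k-1$; flow-admissible means admitting a nowhere-zero $k$-flow for some integer $k$. For flow-admissible $(G,\sigma)$: $\Phi_c(G,\sigma)=\inf\{r:$ circular $r$-flow exists$\}$, $\Phi_i(G,\sigma)=\min\{k:$ nowhere-zero $k$-flow exists$\}$. $(G,\sigma)\in\mathcal{G}_1$ means: for all positive integers $p,q$, whenever $(G,\sigma)$ admits a circular $\frac pq$-flow, it admits a circular $\frac pq$-flow whose flow values have absolute values in $\{1,1+\frac1q,1+\frac2q,\dots,\frac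 pq-1\}$. *)

theory Defs
  imports Complex_Main
begin

text \<open>
  Multigraphs, with parallel edges and loops allowed.  The two half-edges of an edge \<open>e\<close> are
  \<open>(e, False)\<close> and \<open>(e, True)\<close>, and \<open>inc G h\<close> is the vertex at which the half-edge \<open>h\<close> sits.
  The two half-edges are distinct even if \<open>e\<close> is a loop; which of them is called \<open>False\<close> is
  immaterial.
\<close>

type_synonym 'e half_edge = "'e \<times> bool"

record ('v, 'e) multigraph =
  verts :: "'v set"
  edges :: "'e set"
  inc :: "'e half_edge \<Rightarrow> 'v"

locale signed_graph =
  fixes G :: "('v, 'e) multigraph" and \<sigma> :: "'e \<Rightarrow> int"
  assumes finite_verts: "finite (verts G)"
    and finite_edges: "finite (edges G)"
    and inc_verts: "e \<in> edges G \<Longrightarrow> inc G (e, b) \<in> verts G"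
    and signature: "e \<in> edges G \<Longrightarrow> \<sigma> e \<in> {-1, 1}"

definition half_edges_at :: "('v, 'e) multigraph \<Rightarrow> 'v \<Rightarrow> 'e half_edge set" where
  "half_edges_at G v = {h. fst h \<in> edges G \<and> inc G h = v}"

definition joins :: "('v, 'e) multigraph \<Rightarrow> 'e \<Rightarrow> 'v \<Rightarrow> 'v \<Rightarrow> bool" where
  "joins G e u v \<longleftrightarrow> e \<in> edges G \<and> (\<exists>b. inc G (e, b) = u \<and> inc G (e, \<not> b) = v)"

text \<open>
  A circuit is given by a cyclic enumeration of its vertices and edges.  A loop is a circuit of
  length 1; distinctness of the edges matters only in length 2, where two parallel edges are
  required.
\<close>

definition is_circuit :: "('v, 'e) multigraph \<Rightarrow> 'v list \<Rightarrow> 'e list \<Rightarrow> bool" where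
  "is_circuit G vs es \<longleftrightarrow>
     vs \<noteq> [] \<and> length es = length vs \<and> distinct vs \<and> distinct es \<and> set vs \<subseteq> verts G \<and>
     (\<forall>i < length vs. joins G (es ! i) (vs ! i) (vs ! (Suc i mod length vs)))"

definition is_path :: "('v, 'e) multigraph \<Rightarrow> 'v list \<Rightarrow> 'e list \<Rightarrow> bool" where
  "is_path G vs es \<longleftrightarrow>
     length vs = Suc (length es) \<and> distinct vs \<and> set vs \<subseteq> verts G \<and>
     (\<forall>i < length es. joins G (es ! i) (vs ! i) (vs ! Suc i))"

definition balanced :: "('e \<Rightarrow> int) \<Rightarrow> 'e list \<Rightarrow> bool" where
  "balanced \<sigma> es \<longleftrightarrow> even (card {e \<in> set es. \<sigma> e = -1})"

definition has_long_barbell :: "('v, 'e) multigraph \<Rightarrow> ('e \<Rightarrow> int) \<Rightarrow> bool" where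
  "has_long_barbell G \<sigma> \<longleftrightarrow>
     (\<exists>vs\<^sub>1 es\<^sub>1 vs\<^sub>2 es\<^sub>2 ps pes.
        is_circuit G vs\<^sub>1 es\<^sub>1 \<and> \<not> balanced \<sigma> es\<^sub>1 \<and>
        is_circuit G vs\<^sub>2 es\<^sub>2 \<and> \<not> balanced \<sigma> es\<^sub>2 \<and>
        set vs\<^sub>1 \<inter> set vs\<^sub>2 = {} \<and>
        is_path G ps pes \<and>
        set ps \<inter> set vs\<^sub>1 = {hd ps} \<and> set ps \<inter> set vs\<^sub>2 = {last ps})"

definition orientation ::
  "('v, 'e) multigraph \<Rightarrow> ('e \<Rightarrow> int) \<Rightarrow> ('e half_edge \<Rightarrow> int) \<Rightarrow> bool" where
  "orientation G \<sigma> \<tau> \<longleftrightarrow>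
     (\<forall>e \<in> edges G. (\<forall>b. \<tau> (e, b) \<in> {-1, 1}) \<and> \<tau> (e, False) * \<tau> (e, True) = - \<sigma> e)"

definition is_flow ::
  "('v, 'e) multigraph \<Rightarrow> ('e \<Rightarrow> int) \<Rightarrow> ('e half_edge \<Rightarrow> int) \<Rightarrow> ('e \<Rightarrow> real) \<Rightarrow> bool" where
  "is_flow G \<sigma> \<tau> f \<longleftrightarrow>
     orientation G \<sigma> \<tau> \<and>
     (\<forall>v \<in> verts G. (\<Sum>h \<in> half_edges_at G v. real_of_int (\<tau> h) * f (fst h)) = 0)"

definition circular_flow ::
  "('v, 'e) multigraph \<Rightarrow> ('e \<Rightarrow> int) \<Rightarrow> real \<Rightarrow> ('e half_edge \<Rightarrow> int) \<Rightarrow> ('e \<Rightarrow> real) \<Rightarrow> bool" where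
  "circular_flow G \<sigma> r \<tau> f \<longleftrightarrow>
     r \<ge> 2 \<and> is_flow G \<sigma> \<tau> f \<and> (\<forall>e \<in> edges G. 1 \<le> \<bar>f e\<bar> \<and> \<bar>f e\<bar> \<le> r - 1)"

text \<open>
  As for circular flows, \<open>k \<ge> 2\<close> is part of the definition; this only matters for graphs without
  edges, for which both flow numbers below are then 2.
\<close>

definition nowhere_zero_flow ::
  "('v, 'e) multigraph \<Rightarrow> ('e \<Rightarrow> int) \<Rightarrow> nat \<Rightarrow> ('e half_edge \<Rightarrow> int) \<Rightarrow> ('e \<Rightarrow> real) \<Rightarrow> bool" where
  "nowhere_zero_flow G \<sigma> k \<tau> f \<longleftrightarrow>
     k \<ge> 2 \<and> is_flow G \<sigma> \<tau> f \<and>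
     (\<forall>e \<in> edges G. f e \<in> \<int> \<and> 1 \<le> \<bar>f e\<bar> \<and> \<bar>f e\<bar> \<le> real k - 1)"

definition flow_admissible :: "('v, 'e) multigraph \<Rightarrow> ('e \<Rightarrow> int) \<Rightarrow> bool" where
  "flow_admissible G \<sigma> \<longleftrightarrow> (\<exists>k \<tau> f. nowhere_zero_flow G \<sigma> k \<tau> f)"

definition Phi_c :: "('v, 'e) multigraph \<Rightarrow> ('e \<Rightarrow> int) \<Rightarrow> real" where
  "Phi_c G \<sigma> = Inf {r. \<exists>\<tau> f. circular_flow G \<sigma> r \<tau> f}"

definition Phi_i :: "('v, 'e) multigraph \<Rightarrow> ('e \<Rightarrow> int) \<Rightarrow> nat" where
  "Phi_i G \<sigma> = (LEAST k. \<exists>\<tau> f. nowhere_zero_flow G \<sigma> k \<tau> f)"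

definition G1 :: "(('v, 'e) multigraph \<times> ('e \<Rightarrow> int)) set" where
  "G1 = {(G, \<sigma>). \<forall>p q :: nat. p > 0 \<longrightarrow> q > 0 \<longrightarrow>
     (\<exists>\<tau> f. circular_flow G \<sigma> (real p / real q) \<tau> f) \<longrightarrow>
     (\<exists>\<tau> f. circular_flow G \<sigma> (real p / real q) \<tau> f \<and>
        (\<forall>e \<in> edges G. \<bar>f e\<bar> \<in>
           {1 + real i / real q | i :: nat. 1 + real i / real q \<le> real p / real q - 1}))}"

end

theory Submission
  imports Defs
begin

text \<open>
  Every real flow \<open>g\<close> can be rounded to an integral flow that stays between \<open>\<lfloor>g\<rfloor>\<close> and \<open>\<lceil>g\<rceil>\<close>.
  Let \<open>F\<close> be the set of edges with a non-integral value.  If \<open>F\<close> supports a nonzero flow, moving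
  along it makes a further value integral.  Otherwise \<open>F\<close> has at most as many edges as vertices,
  while integrality at each vertex forces degree at least two, so \<open>F\<close> is 2-regular: a disjoint union
  of circuits, unbalanced because a balanced circuit supports a flow, and with half-integral values.
  Summing the flow condition over a component of the graph shows that \<open>F\<close> has an even number of
  negative edges there, so one circuit of \<open>F\<close> comes with a second one in the same component, and a
  shortest path between them completes a long barbell.

  Scaling a circular \<open>p/q\<close>-flow by \<open>q\<close> and rounding gives membership in \<open>G1\<close>; the case \<open>q = 1\<close> gives
  the statement on flow numbers, since by compactness the infimum \<open>Phi_c\<close> is attained.
\<close>

section \<open>Linear systems, moving to an integral point, shortest paths\<close>

text \<open>Gaussian elimination, one row per induction step: a zero row is dropped, any other row
  serves to eliminate one unknown.\<close>

lemma underdetermined_system: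
  fixes A :: "'a \<Rightarrow> 'b \<Rightarrow> real"
  assumes "finite V" "finite E" "card V < card E"
  shows "\<exists>x. (\<exists>e\<in>E. x e \<noteq> 0) \<and> (\<forall>e. e \<notin> E \<longrightarrow> x e = 0) \<and> (\<forall>v\<in>V. (\<Sum>e\<in>E. A v e * x e) = 0)"
  using assms
proof (induction V arbitrary: E A rule: finite_induct)
  case empty
  then obtain e where "e \<in> E" by fastforce
  then show ?case by (intro exI[of _ "\<lambda>e'. if e' = e then 1 else 0"]) auto
next
  case (insert v V)
  show ?case
  proof (cases "\<forall>e\<in>E. A v e = 0")
    case True
    with insert.IH[OF insert.prems(1), of A] insert.prems insert.hyps show ?thesis by auto
  next
    case False
    then obtain e0 where e0: "e0 \<in> E" "A v e0 \<noteq> 0" by blast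
    define E' where "E' = E - {e0}"
    have E: "E = insert e0 E'" "e0 \<notin> E'" "finite E'"
      using e0 insert.prems by (auto simp: E'_def)
    have "card V < card E'"
      using E insert by simp
    \<comment> \<open>Subtracting the multiple of row \<open>v\<close> that clears the column of
      \<open>e0\<close> leaves a system in the unknowns \<open>E'\<close>. The value
      \<open>c\<close> of the unknown \<open>e0\<close> is then found by back substitution into row
      \<open>v\<close>.\<close>
    from insert.IH[OF \<open>finite E'\<close> this, of "\<lambda>u e. A u e - A u e0 / A v e0 * A v e"]
    obtain x where x: "\<exists>e\<in>E'. x e \<noteq> 0" "\<forall>e. e \<notin> E' \<longrightarrow> x e = 0"
      and eq: "\<forall>u\<in>V. (\<Sum>e\<in>E'. (A u e - A u e0 / A v e0 * A v e) * x e) = 0"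
      by blast
    define c where "c = - (\<Sum>e\<in>E'. A v e * x e) / A v e0"
    have sum: "(\<Sum>e\<in>E. A u e * (x(e0 := c)) e) = A u e0 * c + (\<Sum>e\<in>E'. A u e * x e)" for u
    proof -
      have "(\<Sum>e\<in>E'. A u e * (x(e0 := c)) e) = (\<Sum>e\<in>E'. A u e * x e)"
        using E by (intro sum.cong) auto
      with E show ?thesis by simp
    qed
    have "(\<Sum>e\<in>E. A u e * (x(e0 := c)) e) = 0" if "u \<in> insert v V" for u
    proof (cases "u = v")
      case True
      then show ?thesis using e0 unfolding sum by (simp add: c_def)
    next
      case False
      with that eq have "(\<Sum>e\<in>E'. (A u e - A u e0 / A v e0 * A v e) * x e) = 0" by blast
      then have "(\<Sum>e\<in>E'. A u e * x e) = A u e0 / A v e0 * (\<Sum>e\<in>E'. A v e * x e)"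
        by (simp add: algebra_simps sum_subtractf sum_distrib_left sum_divide_distrib)
      then show ?thesis unfolding sum by (simp add: c_def)
    qed
    moreover have "\<exists>e\<in>E. (x(e0 := c)) e \<noteq> 0" using x E by auto
    moreover have "\<forall>e. e \<notin> E \<longrightarrow> (x(e0 := c)) e = 0" using x E by auto
    ultimately show ?thesis by blast
  qed
qed

text \<open>Start at \<open>g\<close> and move in direction \<open>x\<close> until the first moving
  coordinate arrives at an integer. Up to that moment no coordinate has passed the floor or ceiling
  of its initial value.\<close>

lemma push_to_integer:
  fixes g x :: "'a \<Rightarrow> real"
  assumes "finite F" "\<exists>e\<in>F. x e \<noteq> 0" "\<forall>e\<in>F. g e \<notin> \<int>"
  shows "\<exists>t. (\<forall>e\<in>F. of_int \<lfloor>g e\<rfloor> \<le> g e + t * x e \<and> g e + t * x e \<le> of_int \<lceil>g e\<rceil>) \<and>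
             (\<exists>e\<in>F. g e + t * x e \<in> \<int>)"
proof -
  define S where "S = {e \<in> F. x e \<noteq> 0}"
  \<comment> \<open>\<open>b e\<close> is the integer that coordinate \<open>e\<close> heads for and
    \<open>T e\<close> its arrival time. Coordinates with \<open>x e = 0\<close> stay put and are
    left out of the minimum.\<close>
  define b :: "'a \<Rightarrow> real" where "b e = (if x e > 0 then of_int \<lceil>g e\<rceil> else of_int \<lfloor>g e\<rfloor>)" for e
  define T where "T e = (b e - g e) / x e" for e
  define t where "t = Min (T ` S)"
  have S: "finite S" "S \<noteq> {}" using assms by (auto simp: S_def)
  have T_nonneg: "0 \<le> T e" if "e \<in> S" for e
    using that by (auto simp: T_def b_def S_def zero_le_divide_iff le_ceiling_iff)
  obtain e0 where e0: "e0 \<in> S" "t = T e0"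
    using Min_in[of "T ` S"] S unfolding t_def by blast
  have "0 \<le> t" using e0 T_nonneg by simp
  have "g e0 + t * x e0 = b e0" using e0 by (simp add: T_def S_def)
  then have "g e0 + t * x e0 \<in> \<int>" by (simp add: b_def)
  moreover have "of_int \<lfloor>g e\<rfloor> \<le> g e + t * x e \<and> g e + t * x e \<le> of_int \<lceil>g e\<rceil>" if "e \<in> F" for e
  proof (cases "x e = 0")
    case True
    then show ?thesis by simp
  next
    case False
    with that have "e \<in> S" by (simp add: S_def)
    then have le: "t \<le> T e" using S by (simp add: t_def)
    show ?thesis
    proof (cases "x e > 0")
      case True
      then have "t * x e \<le> of_int \<lceil>g e\<rceil> - g e"
        using le by (simp add: T_def b_def pos_le_divide_eq)
      moreover have "0 \<le> t * x e" using True \<open>0 \<le> t\<close> by simp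
      moreover have "of_int \<lfloor>g e\<rfloor> \<le> g e" by simp
      ultimately show ?thesis by linarith
    next
      case neg: False
      with False have "x e < 0" by simp
      then have "of_int \<lfloor>g e\<rfloor> - g e \<le> t * x e"
        using le neg by (simp add: T_def b_def neg_le_divide_eq)
      moreover have "t * x e \<le> 0" using \<open>x e < 0\<close> \<open>0 \<le> t\<close> by (simp add: mult_le_0_iff)
      moreover have "g e \<le> of_int \<lceil>g e\<rceil>" by simp
      ultimately show ?thesis by linarith
    qed
  qed
  ultimately show ?thesis using e0 by (auto simp: S_def)
qed

lemma connecting_path:
  assumes "(u, v) \<in> R\<^sup>*" "u \<in> A" "v \<in> B"
  shows "\<exists>ps. ps \<noteq> [] \<and> distinct ps \<and> successively (\<lambda>x y. (x, y) \<in> R) ps \<and>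
    set ps \<inter> A = {hd ps} \<and> set ps \<inter> B = {last ps}"
proof -
  \<comment> \<open>a shortest walk from \<open>A\<close> to \<open>B\<close> has the required properties\<close>
  let ?W = "\<lambda>ps. ps \<noteq> [] \<and> successively (\<lambda>x y. (x, y) \<in> R) ps \<and> hd ps \<in> A \<and> last ps \<in> B"
  have "\<exists>ps. ps \<noteq> [] \<and> successively (\<lambda>x y. (x, y) \<in> R) ps \<and> hd ps = u \<and> last ps = v"
    using assms(1)
  proof (induction rule: converse_rtrancl_induct)
    case base
    then show ?case by (intro exI[of _ "[v]"]) simp
  next
    case (step x y)
    then obtain ps where "ps \<noteq> []" "successively (\<lambda>x y. (x, y) \<in> R) ps" "hd ps = y" "last ps = v"
      by blast
    with step.hyps show ?case
      by (intro exI[of _ "x # ps"]) (auto simp: successively_Cons)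
  qed
  with assms obtain p where "?W p" by blast
  then obtain ps where ps: "?W ps" and least: "\<And>qs. ?W qs \<Longrightarrow> length ps \<le> length qs"
    using ex_has_least_nat[of ?W p length] by blast
  have "distinct ps"
  proof (rule ccontr)
    assume "\<not> distinct ps"
    then obtain xs ys zs y where eq: "ps = xs @ [y] @ ys @ [y] @ zs"
      using not_distinct_decomp by blast
    \<comment> \<open>Cutting out the detour at \<open>y\<close> (or, below, the part before a
      vertex of \<open>A\<close> or after a vertex of \<open>B\<close>) leaves a walk of the same
      kind, so by minimality there is nothing to cut.\<close>
    have "?W (xs @ [y] @ zs)"
      using ps unfolding eq by (auto simp: successively_append_iff successively_Cons hd_append)
    from least[OF this] show False by (simp add: eq)
  qed
  moreover have "a = hd ps" if a: "a \<in> set ps" "a \<in> A" for a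
  proof -
    obtain xs ys where eq: "ps = xs @ a # ys" using a by (meson split_list)
    have "?W (a # ys)"
      using ps a unfolding eq by (auto simp: successively_append_iff)
    from least[OF this] show ?thesis by (simp add: eq)
  qed
  moreover have "b = last ps" if b: "b \<in> set ps" "b \<in> B" for b
  proof -
    obtain xs ys where eq: "ps = xs @ b # ys" using b by (meson split_list)
    have "?W (xs @ [b])"
      using ps b unfolding eq by (auto simp: successively_append_iff successively_Cons hd_append)
    from least[OF this] show ?thesis by (simp add: eq)
  qed
  ultimately show ?thesis
    using ps hd_in_set[of ps] last_in_set[of ps] by (intro exI[of _ ps]) blast
qed

section \<open>Half-edges and the net flow at a vertex\<close>

definition opp :: "'e half_edge \<Rightarrow> 'e half_edge" where
  "opp h = (fst h, \<not> snd h)"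

lemma opp_simps [simp]: "fst (opp h) = fst h" "opp (opp h) = h" "opp h \<noteq> h"
  by (auto simp: opp_def prod_eq_iff)

lemma eq_or_opp: "fst h = fst h' \<Longrightarrow> h = h' \<or> h = opp h'"
  by (auto simp: opp_def prod_eq_iff)

definition netflow ::
  "('v, 'e) multigraph \<Rightarrow> ('e half_edge \<Rightarrow> int) \<Rightarrow> ('e \<Rightarrow> real) \<Rightarrow> 'v \<Rightarrow> real" where
  "netflow G \<tau> f v = (\<Sum>h\<in>half_edges_at G v. real_of_int (\<tau> h) * f (fst h))"

lemma is_flow_netflow:
  "is_flow G \<sigma> \<tau> f \<longleftrightarrow> orientation G \<sigma> \<tau> \<and> (\<forall>v\<in>verts G. netflow G \<tau> f v = 0)"
  by (simp add: is_flow_def netflow_def)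

lemma netflow_add_mult:
  "netflow G \<tau> (\<lambda>e. f e + t * x e) v = netflow G \<tau> f v + t * netflow G \<tau> x v"
  by (simp add: netflow_def algebra_simps sum.distrib sum_distrib_left)

lemma orientation_sign: "orientation G \<sigma> \<tau> \<Longrightarrow> fst h \<in> edges G \<Longrightarrow> \<tau> h = 1 \<or> \<tau> h = -1"
  by (cases h) (auto simp: orientation_def)

lemma orientation_opp:
  "orientation G \<sigma> \<tau> \<Longrightarrow> fst h \<in> edges G \<Longrightarrow> \<tau> (opp h) * \<tau> h = - \<sigma> (fst h)"
  by (cases h; cases "snd h") (auto simp: orientation_def opp_def mult.commute)

context signed_graph
begin

lemma finite_half_edges_at: "finite (half_edges_at G v)"
proof -
  have "half_edges_at G v \<subseteq> edges G \<times> UNIV" by (auto simp: half_edges_at_def)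
  then show ?thesis by (rule finite_subset) (simp add: finite_edges)
qed

lemma netflow_support:
  assumes "F \<subseteq> edges G" "\<forall>e. e \<notin> F \<longrightarrow> x e = 0"
  shows "netflow G \<tau> x v = (\<Sum>h | fst h \<in> F \<and> inc G h = v. real_of_int (\<tau> h) * x (fst h))"
  unfolding netflow_def
  by (rule sum.mono_neutral_right[OF finite_half_edges_at]) (use assms in \<open>auto simp: half_edges_at_def\<close>)

lemma inc_verts': "fst h \<in> edges G \<Longrightarrow> inc G h \<in> verts G"
  using inc_verts by (cases h) auto

lemma half_edge_joins: "fst h \<in> edges G \<Longrightarrow> joins G (fst h) (inc G h) (inc G (opp h))"
  unfolding joins_def opp_def by (cases h) auto

text \<open>Turns the parity of negative edges into a product of signs, the form in which it appears
  when a flow is propagated around a cycle.\<close>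

lemma prod_signature:
  "set es \<subseteq> edges G \<Longrightarrow> distinct es \<Longrightarrow> prod_list (map \<sigma> es) = (if balanced \<sigma> es then 1 else -1)"
proof (induction es)
  case Nil
  then show ?case by (simp add: balanced_def)
next
  case (Cons e es)
  have "{e' \<in> set (e # es). \<sigma> e' = -1} =
    (if \<sigma> e = -1 then insert e {e' \<in> set es. \<sigma> e' = -1} else {e' \<in> set es. \<sigma> e' = -1})"
    by auto
  moreover have "\<sigma> e = 1 \<or> \<sigma> e = -1" using Cons signature[of e] by auto
  ultimately show ?case using Cons by (auto simp: balanced_def)
qed

end

subsection \<open>Two-regular edge sets and their cycles\<close>

text \<open>Degree two is stated through half-edges, so that a loop counts twice at its vertex and
  forms a cycle by itself, its two half-edges being mates.\<close>

locale two_regular = signed_graph +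
  fixes F :: "'b set"
  assumes F_edges: "F \<subseteq> edges G"
    and ex1_mate: "fst h \<in> F \<Longrightarrow> \<exists>!h'. fst h' \<in> F \<and> inc G h' = inc G h \<and> h' \<noteq> h"
begin

definition mate :: "'b half_edge \<Rightarrow> 'b half_edge" where
  "mate h = (THE h'. fst h' \<in> F \<and> inc G h' = inc G h \<and> h' \<noteq> h)"

lemma mate:
  assumes "fst h \<in> F"
  shows "fst (mate h) \<in> F" "inc G (mate h) = inc G h" "mate h \<noteq> h"
  using theI'[OF ex1_mate[OF assms]] unfolding mate_def by auto

lemma mate_eqI: "fst h \<in> F \<Longrightarrow> fst h' \<in> F \<Longrightarrow> inc G h' = inc G h \<Longrightarrow> h' \<noteq> h \<Longrightarrow> h' = mate h"
  using ex1_mate[of h] mate[of h] by blast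

lemma mate_mate [simp]: "fst h \<in> F \<Longrightarrow> mate (mate h) = h"
  using mate_eqI[of "mate h" h] mate[of h] by auto

lemma half_edges_at_F: "fst h \<in> F \<Longrightarrow> {h'. fst h' \<in> F \<and> inc G h' = inc G h} = {h, mate h}"
  using mate mate_eqI by blast

text \<open>A half-edge stands for its edge traversed away from \<open>inc G h\<close>: cross to the
  far end, then leave through the other half-edge of \<open>F\<close> there.\<close>

definition step :: "'b half_edge \<Rightarrow> 'b half_edge" where
  "step h = mate (opp h)"

lemma step_in: "fst h \<in> F \<Longrightarrow> fst (step h) \<in> F"
  by (simp add: step_def mate)

lemma inc_step: "fst h \<in> F \<Longrightarrow> inc G (step h) = inc G (opp h)"
  by (simp add: step_def mate)

lemma mate_step: "fst h \<in> F \<Longrightarrow> mate (step h) = opp h"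
  by (simp add: step_def)

lemma step_inj: "fst h \<in> F \<Longrightarrow> fst h' \<in> F \<Longrightarrow> step h = step h' \<Longrightarrow> h = h'"
  by (metis mate_step opp_simps(2))

lemma funpow_step_in: "fst h \<in> F \<Longrightarrow> fst ((step ^^ k) h) \<in> F"
  by (induction k) (simp_all add: step_in)

text \<open>\<open>mate\<close> conjugates \<open>step\<close> to its inverse, so a walk that returned to its starting vertex
  through the other half-edge would have a fixed point of \<open>mate\<close> or \<open>opp\<close> in its middle.\<close>

lemma funpow_step_neq_mate: "fst h \<in> F \<Longrightarrow> (step ^^ k) h \<noteq> mate h"
proof (induction k arbitrary: h rule: less_induct)
  case (less k)
  consider "k = 0" | "k = 1" | m where "k = Suc (Suc m)"
    by (metis One_nat_def not0_implies_Suc)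
  then show ?case
  proof cases
    case 1
    then show ?thesis using mate(3)[OF less.prems] by auto
  next
    case 2
    show ?thesis
    proof
      assume "(step ^^ k) h = mate h"
      then have "mate (mate (opp h)) = mate (mate h)" using 2 by (simp add: step_def)
      then show False using less.prems opp_simps(3)[of h] by simp
    qed
  next
    case 3
    let ?h = "(step ^^ m) (step h)"
    show ?thesis
    proof
      assume "(step ^^ k) h = mate h"
      then have "step ?h = mate h"
        by (simp add: 3 funpow_swap1)
      then have "mate (step ?h) = h"
        using less.prems by simp
      then have "opp ?h = h"
        using mate_step[of ?h] funpow_step_in[of "step h" m] less.prems step_in by simp
      then have "?h = mate (step h)"
        using mate_step[OF less.prems] by (metis opp_simps(2))
      moreover have "m < k" using 3 by simp
      ultimately show False
        using less.IH[of m "step h"] less.prems step_in by blast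
    qed
  qed
qed

text \<open>One period of an orbit of \<open>step\<close>: \<open>hs ! i\<close> is the half-edge
  through which the walk leaves its \<open>i\<close>-th vertex.\<close>

definition is_cycle :: "'b half_edge list \<Rightarrow> bool" where
  "is_cycle hs \<longleftrightarrow> hs \<noteq> [] \<and> (\<forall>h\<in>set hs. fst h \<in> F) \<and>
     (\<forall>i<length hs. hs ! (Suc i mod length hs) = step (hs ! i)) \<and>
     distinct (map fst hs) \<and> distinct (map (inc G) hs)"

lemma cycle_in_F: "is_cycle hs \<Longrightarrow> h \<in> set hs \<Longrightarrow> fst h \<in> F"
  by (simp add: is_cycle_def)

lemma cycle_nth_Suc: "is_cycle hs \<Longrightarrow> i < length hs \<Longrightarrow> hs ! (Suc i mod length hs) = step (hs ! i)"
  by (simp add: is_cycle_def)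

text \<open>On the finite set of half-edges of \<open>F\<close>, \<open>step\<close> is injective,
  so the orbit of \<open>h\<close> returns to \<open>h\<close>. A repeated vertex or edge within one
  period would put a half-edge and its mate into the same orbit, which
  \<open>funpow_step_neq_mate\<close> forbids.\<close>

lemma cycle_through:
  assumes h: "fst h \<in> F"
  shows "\<exists>hs. is_cycle hs \<and> h \<in> set hs"
proof -
  let ?s = "\<lambda>i. (step ^^ i) h"
  have in_F: "fst (?s i) \<in> F" for i using h by (rule funpow_step_in)
  \<comment> \<open>By injectivity any repetition can be shifted back to the start, so the orbit has
    no tail before its period.\<close>
  have cancel: "?s (j - i) = h" if "i \<le> j" "?s j = ?s i" for i j
    using that
  proof (induction i arbitrary: j)
    case 0
    then show ?case by simp
  next
    case (Suc i)
    then obtain j' where j': "j = Suc j'" by (cases j) auto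
    with Suc have "?s j' = ?s i"
      using step_inj[OF in_F in_F] by simp
    with Suc j' show ?case by simp
  qed
  have "finite (F \<times> (UNIV :: bool set))"
    using F_edges finite_edges finite_subset by (metis finite_SigmaI finite)
  moreover have "range ?s \<subseteq> F \<times> UNIV" using in_F by (simp add: image_subset_iff mem_Times_iff)
  ultimately have "finite (range ?s)" by (rule rev_finite_subset)
  then have "\<not> inj ?s" using finite_imageD infinite_UNIV_nat by blast
  then obtain i j where "i < j" "?s i = ?s j"
    using linorder_injI[of ?s] by blast
  then have ex: "\<exists>n>0. ?s n = h" using cancel[of i j] by (intro exI[of _ "j - i"]) auto
  define n where "n = (LEAST n. n > 0 \<and> ?s n = h)"
  have n: "n > 0" "?s n = h" using LeastI_ex[OF ex] by (auto simp: n_def)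
  have minimal: "\<not> (0 < m \<and> ?s m = h)" if "m < n" for m
    using not_less_Least that unfolding n_def by blast
  have inj: "inj_on ?s {..<n}"
  proof (rule linorder_inj_onI)
    fix i j assume "i < j" "j \<in> {..<n}"
    with cancel[of i j] minimal[of "j - i"] show "?s i \<noteq> ?s j" by auto
  qed auto
  have not_mate: "?s i \<noteq> mate (?s j)" for i j
  proof (cases "j \<le> i")
    case True
    then have "?s i = (step ^^ (i - j)) (?s j)"
      by (metis comp_apply funpow_add le_add_diff_inverse2)
    then show ?thesis using funpow_step_neq_mate[OF in_F] by simp
  next
    case False
    then have "?s j = (step ^^ (j - i)) (?s i)"
      by (metis comp_apply funpow_add le_add_diff_inverse2 nat_le_linear)
    then have "mate (?s i) \<noteq> ?s j" using funpow_step_neq_mate[OF in_F] by metis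
    then show ?thesis using in_F by (metis mate_mate)
  qed
  define hs where "hs = map ?s [0..<n]"
  have len: "length hs = n" and nth: "\<And>i. i < n \<Longrightarrow> hs ! i = ?s i" by (auto simp: hs_def)
  have "\<forall>h\<in>set hs. fst h \<in> F" using in_F by (auto simp: hs_def simp del: funpow.simps)
  moreover have "hs ! (Suc i mod n) = step (hs ! i)" if "i < n" for i
    using that n by (cases "Suc i = n") (auto simp: nth)
  moreover have "inj_on (fst \<circ> ?s) {..<n}"
  proof (rule inj_onI)
    fix i j assume ij: "i \<in> {..<n}" "j \<in> {..<n}" "(fst \<circ> ?s) i = (fst \<circ> ?s) j"
    then consider "?s i = ?s j" | "?s i = opp (?s j)"
      using eq_or_opp[of "?s i" "?s j"] by auto
    then show "i = j"
    proof cases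
      case 1
      then show ?thesis using inj_onD[OF inj _ ij(1,2)] by simp
    next
      case 2
      \<comment> \<open>The arriving half-edge \<open>opp (?s j)\<close> is the mate of the next
        departing one, so a repeated edge is again a pair of mates.\<close>
      then have "?s i = mate (?s (Suc j))" using mate_step[OF in_F] by simp
      then show ?thesis using not_mate by blast
    qed
  qed
  moreover have "inj_on (inc G \<circ> ?s) {..<n}"
  proof (rule inj_onI)
    fix i j assume ij: "i \<in> {..<n}" "j \<in> {..<n}" "(inc G \<circ> ?s) i = (inc G \<circ> ?s) j"
    then have "?s i = ?s j"
      using mate_eqI[OF in_F in_F, of i j] not_mate[of i j] by (auto simp: comp_def)
    then show "i = j" using inj_onD[OF inj _ ij(1,2)] by simp
  qed
  moreover have "hs \<noteq> []" using n len by auto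
  moreover have "map fst hs = map (fst \<circ> ?s) [0..<n]" "map (inc G) hs = map (inc G \<circ> ?s) [0..<n]"
    by (simp_all add: hs_def)
  ultimately have "is_cycle hs"
    unfolding is_cycle_def len by (simp only: distinct_map distinct_upt set_upt lessThan_atLeast0) blast
  moreover have "h \<in> set hs" using nth[OF n(1)] nth_mem[of 0 hs] n(1) len by simp
  ultimately show ?thesis by blast
qed

lemma cycle_is_circuit:
  assumes "is_cycle hs"
  shows "is_circuit G (map (inc G) hs) (map fst hs)"
proof -
  have "fst h \<in> edges G" if "h \<in> set hs" for h
    using that assms F_edges by (auto simp: is_cycle_def)
  moreover have "inc G (hs ! (Suc i mod length hs)) = inc G (opp (hs ! i))" if "i < length hs" for i
    using that assms inc_step[of "hs ! i"] by (auto simp: is_cycle_def)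
  moreover have "Suc i mod length hs < length hs" if "i < length hs" for i
    using that by (metis gr_zeroI less_zeroE mod_less_divisor)
  ultimately show ?thesis
    using assms half_edge_joins inc_verts' by (auto simp: is_circuit_def is_cycle_def)
qed

text \<open>Identifies the second half-edge at a vertex of the cycle: the one through which the
  preceding edge arrives. For index 0 the predecessor is the last index.\<close>

lemma cycle_pred:
  assumes "is_cycle hs" "h \<in> set hs"
  obtains i where "i < length hs" "h = hs ! (Suc i mod length hs)" "mate h = opp (hs ! i)"
proof -
  obtain j where j: "j < length hs" "h = hs ! j" using assms by (auto simp: in_set_conv_nth)
  obtain i where i: "i < length hs" "Suc i mod length hs = j"
  proof (cases j)
    case 0
    with j show ?thesis by (intro that[of "length hs - 1"]) auto
  next
    case (Suc i)
    with j show ?thesis by (intro that[of i]) auto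
  qed
  then have "h = step (hs ! i)" "fst (hs ! i) \<in> F" using assms j by (auto simp: is_cycle_def)
  with i j mate_step[of "hs ! i"] show ?thesis by (intro that[of i]) simp_all
qed

lemma cycle_step: "is_cycle hs \<Longrightarrow> h \<in> set hs \<Longrightarrow> step h \<in> set hs"
  unfolding is_cycle_def by (metis in_set_conv_nth length_pos_if_in_set mod_less_divisor nth_mem)

text \<open>A cycle is a whole component of \<open>F\<close>: its edges are closed under passing to
  the mate, forwards by \<open>step\<close> and backwards by \<open>cycle_pred\<close>.\<close>

lemma cycle_mate_iff:
  assumes c: "is_cycle hs" and h: "fst h \<in> F"
  shows "fst (mate h) \<in> fst ` set hs \<longleftrightarrow> fst h \<in> fst ` set hs"
proof -
  have *: "fst (mate h) \<in> fst ` set hs" if "fst h \<in> F" "fst h \<in> fst ` set hs" for h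
  proof -
    from that obtain h' where h': "h' \<in> set hs" "fst h = fst h'" by auto
    then consider "h = h'" | "h = opp h'" using eq_or_opp by blast
    then show ?thesis
    proof cases
      case 1
      with h' c obtain i where "i < length hs" "mate h = opp (hs ! i)" using cycle_pred by metis
      then show ?thesis by auto
    next
      case 2
      with cycle_step[OF c h'(1)] show ?thesis by (auto simp: step_def)
    qed
  qed
  from *[of h] *[of "mate h"] h mate show ?thesis by auto
qed

text \<open>A single edge off \<open>hs\<close> suffices: walking around \<open>hs'\<close> from it,
  \<open>cycle_mate_iff\<close> keeps every edge off \<open>hs\<close>. At a common vertex the two
  half-edges would be equal or mates, hence both on \<open>hs\<close>.\<close>

lemma cycles_disjoint:
  assumes c: "is_cycle hs" "is_cycle hs'" and h: "h \<in> set hs'" "fst h \<notin> fst ` set hs"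
  shows "inc G ` set hs \<inter> inc G ` set hs' = {}"
proof -
  have F: "fst h' \<in> F" if "h' \<in> set hs \<union> set hs'" for h'
    using that c cycle_in_F by blast
  obtain k where k: "k < length hs'" "h = hs' ! k" using h by (auto simp: in_set_conv_nth)
  have ne: "hs' \<noteq> []" using h by auto
  have rot: "fst (hs' ! ((k + i) mod length hs')) \<notin> fst ` set hs" for i
  proof (induction i)
    case 0
    then show ?case using h k by simp
  next
    case (Suc i)
    let ?j = "(k + i) mod length hs'"
    have j: "?j < length hs'" using ne by simp
    have "hs' ! ((k + Suc i) mod length hs') = step (hs' ! ?j)"
      using cycle_nth_Suc[OF c(2) j] by (simp add: mod_Suc_eq)
    moreover have "fst (opp (hs' ! ?j)) \<in> F" using F j by simp
    ultimately show ?case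
      using cycle_mate_iff[OF c(1), of "opp (hs' ! ?j)"] Suc by (simp add: step_def)
  qed
  have out: "fst h' \<notin> fst ` set hs" if h': "h' \<in> set hs'" for h'
  proof -
    obtain j where j: "j < length hs'" "h' = hs' ! j" using h' by (auto simp: in_set_conv_nth)
    \<comment> \<open>Going on to the end of the list and then \<open>j\<close> further reaches
      index \<open>j\<close> from \<open>k\<close>, whichever of the two is larger.\<close>
    have "k + (length hs' - k + j) = j + length hs'" using k by simp
    then have "(k + (length hs' - k + j)) mod length hs' = j" using j by simp
    with rot[of "length hs' - k + j"] j show ?thesis by simp
  qed
  have "inc G h1 \<noteq> inc G h2" if "h1 \<in> set hs" "h2 \<in> set hs'" for h1 h2
  proof
    assume "inc G h1 = inc G h2"
    with that have "h2 = h1 \<or> h2 = mate h1" using F mate_eqI[of h1 h2] by auto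
    then have "fst h2 \<in> fst ` set hs" using that cycle_mate_iff[OF c(1), of h1] F by auto
    with out that show False by blast
  qed
  then show ?thesis by auto
qed

text \<open>Propagate a value of modulus 1 along the cycle, adjusting its sign at each vertex. After
  one round it has picked up the product of all signs, which is 1 for a balanced cycle, so the
  condition at the first vertex holds too.\<close>

lemma balanced_cycle_flow:
  assumes c: "is_cycle hs" and bal: "balanced \<sigma> (map fst hs)" and o: "orientation G \<sigma> \<tau>"
  shows "\<exists>x. (\<exists>e\<in>F. x e \<noteq> 0) \<and> (\<forall>e. e \<notin> F \<longrightarrow> x e = 0) \<and> (\<forall>v. netflow G \<tau> x v = 0)"
proof -
  let ?n = "length hs" and ?e = "\<lambda>i. fst (hs ! i)"
  define y where "y i = prod_list (map \<sigma> (take i (map fst hs)))" for i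
  \<comment> \<open>The sum has at most one nonzero term, as the edges are distinct; it carries
    values from positions over to edges and gives 0 off the cycle.\<close>
  define x where "x e = (\<Sum>i<?n. if ?e i = e then real_of_int (\<tau> (hs ! i) * y i) else 0)" for e
  have F: "?e i \<in> F" and E: "?e i \<in> edges G" if "i < ?n" for i
    using that c F_edges by (auto simp: is_cycle_def)
  have n: "?n > 0" using c by (auto simp: is_cycle_def)
  have x_nth: "x (?e i) = real_of_int (\<tau> (hs ! i) * y i)" if "i < ?n" for i
  proof -
    have "?e j = ?e i \<longleftrightarrow> j = i" if "j < ?n" for j
      using that \<open>i < ?n\<close> c nth_eq_iff_index_eq[of "map fst hs" j i] by (auto simp: is_cycle_def)
    then have "x (?e i) = (\<Sum>j<?n. if j = i then real_of_int (\<tau> (hs ! i) * y i) else 0)"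
      unfolding x_def by (intro sum.cong) auto
    then show ?thesis using that by simp
  qed
  have x_zero: "x e = 0" if "e \<notin> fst ` set hs" for e
    unfolding x_def using that by (intro sum.neutral) auto
  have "prod_list (map \<sigma> (map fst hs)) = 1"
    using prod_signature[of "map fst hs"] bal c F_edges by (auto simp: is_cycle_def)
  then have y_n: "y ?n = 1" by (simp add: y_def)
  have y_Suc: "y (Suc i) = y i * \<sigma> (?e i)" if "i < ?n" for i
    using that by (simp add: y_def take_Suc_conv_app_nth)
  \<comment> \<open>Balance enters only here, where the last index wraps around to 0 and
    \<open>y ?n = 1 = y 0\<close>.\<close>
  have y_mod: "y (Suc i mod ?n) = y i * \<sigma> (?e i)" if "i < ?n" for i
  proof (cases "Suc i = ?n")
    case True
    then show ?thesis using y_n y_Suc[OF that] by (simp add: y_def)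
  next
    case False
    then show ?thesis using that y_Suc by simp
  qed
  have sq: "\<tau> h * \<tau> h = 1" if "fst h \<in> edges G" for h
    using orientation_sign[OF o that] by auto
  have zero: "real_of_int (\<tau> h) * x (fst h) + real_of_int (\<tau> (mate h)) * x (fst (mate h)) = 0"
    if h: "h \<in> set hs" for h
  proof -
    from cycle_pred[OF c h] obtain i where i: "i < ?n" "h = hs ! (Suc i mod ?n)" "mate h = opp (hs ! i)" .
    \<comment> \<open>The departing half-edge contributes \<open>y ?j\<close>; the arriving one
      contributes \<open>- (\<sigma> (?e i) * y i)\<close>, which is \<open>- y ?j\<close>.\<close>
    let ?j = "Suc i mod ?n"
    have j: "?j < ?n" using n by simp
    have "\<tau> (hs ! ?j) * (\<tau> (hs ! ?j) * y ?j) = y ?j"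
      using sq[OF E[OF j]] by (metis mult.assoc mult_1)
    moreover have "\<tau> (opp (hs ! i)) * (\<tau> (hs ! i) * y i) = - (\<sigma> (?e i) * y i)"
      using orientation_opp[OF o E[OF i(1)]] by (metis mult.assoc mult_minus_left)
    ultimately have "\<tau> (hs ! ?j) * (\<tau> (hs ! ?j) * y ?j) + \<tau> (opp (hs ! i)) * (\<tau> (hs ! i) * y i) = 0"
      using y_mod[OF i(1)] by simp
    then have "real_of_int (\<tau> (hs ! ?j) * (\<tau> (hs ! ?j) * y ?j) + \<tau> (opp (hs ! i)) * (\<tau> (hs ! i) * y i)) = 0"
      by simp
    then show ?thesis
      unfolding i(2,3) using x_nth[OF j] x_nth[OF i(1)] by (simp only: opp_simps of_int_add of_int_mult i(3)[unfolded i(2)])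
  qed
  have x_F: "\<forall>e. e \<notin> F \<longrightarrow> x e = 0"
    using x_zero c by (auto simp: is_cycle_def intro!: x_zero)
  note netflow_supp = netflow_support[OF F_edges x_F]
  have "netflow G \<tau> x v = 0" for v
  proof (cases "\<exists>h. fst h \<in> F \<and> inc G h = v")
    case False
    then have empty: "{h. fst h \<in> F \<and> inc G h = v} = {}" by blast
    show ?thesis unfolding netflow_supp empty by simp
  next
    case True
    then obtain h where h: "fst h \<in> F" "inc G h = v" by blast
    have "netflow G \<tau> x v = (\<Sum>h'\<in>{h, mate h}. real_of_int (\<tau> h') * x (fst h'))"
      unfolding netflow_supp using half_edges_at_F[OF h(1)] h(2) by simp
    also have "\<dots> = real_of_int (\<tau> h) * x (fst h) + real_of_int (\<tau> (mate h)) * x (fst (mate h))"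
      using mate(3)[OF h(1)] by simp
    also have "\<dots> = 0"
    proof (cases "fst h \<in> fst ` set hs")
      case False
      then show ?thesis using cycle_mate_iff[OF c h(1)] x_zero by simp
    next
      case True
      then obtain h' where h': "h' \<in> set hs" "fst h = fst h'" by auto
      then consider "h = h'" | "h = opp h'" using eq_or_opp by blast
      then show ?thesis
      proof cases
        case 1
        then show ?thesis using zero[OF h'(1)] by simp
      next
        case 2
        then have "mate h \<in> set hs" using cycle_step[OF c h'(1)] by (simp add: step_def)
        then show ?thesis using zero[of "mate h"] h by simp
      qed
    qed
    finally show ?thesis .
  qed
  moreover have "x (?e 0) \<noteq> 0"
    using x_nth[OF n] orientation_sign[OF o E[OF n]] by (auto simp: y_def)
  ultimately show ?thesis using F[OF n] x_F by blast
qed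

end

subsection \<open>Rounding flows to integers\<close>

lemma Ints_add_eq_0: "a \<in> \<int> \<Longrightarrow> a + b = 0 \<Longrightarrow> (b :: real) \<in> \<int>"
  by (metis Ints_minus add_eq_0_iff)

context signed_graph
begin

text \<open>Independence in the signed-graphic matroid.\<close>

definition independent :: "('e half_edge \<Rightarrow> int) \<Rightarrow> 'e set \<Rightarrow> bool" where
  "independent \<tau> F \<longleftrightarrow>
     (\<forall>x. (\<forall>e. e \<notin> F \<longrightarrow> x e = 0) \<longrightarrow> (\<forall>v\<in>verts G. netflow G \<tau> x v = 0) \<longrightarrow> (\<forall>e\<in>F. x e = 0))"

text \<open>Only endpoints of \<open>F\<close> impose conditions on a function supported on
  \<open>F\<close>. With more edges than endpoints, the system has a nonzero solution.\<close>

lemma card_independent_le: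
  assumes F: "F \<subseteq> edges G" and indep: "independent \<tau> F"
  shows "card F \<le> card (inc G ` (F \<times> UNIV))"
proof (rule ccontr)
  let ?W = "inc G ` (F \<times> UNIV)"
  \<comment> \<open>The incidence matrix; summing over both half-edges gives a loop its two
    contributions at one vertex.\<close>
  let ?A = "\<lambda>v e. \<Sum>b\<in>UNIV. if inc G (e, b) = v then real_of_int (\<tau> (e, b)) else 0"
  assume "\<not> card F \<le> card ?W"
  moreover have fin: "finite F" using F finite_edges finite_subset by blast
  ultimately obtain x where x: "\<exists>e\<in>F. x e \<noteq> 0" "\<forall>e. e \<notin> F \<longrightarrow> x e = 0"
    and zero: "\<forall>v\<in>?W. (\<Sum>e\<in>F. ?A v e * x e) = 0"
    using underdetermined_system[of ?W F ?A] by auto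
  have "netflow G \<tau> x v = 0" for v
  proof (cases "v \<in> ?W")
    case True
    have "netflow G \<tau> x v = (\<Sum>h\<in>{h\<in>F \<times> UNIV. inc G h = v}. real_of_int (\<tau> h) * x (fst h))"
      unfolding netflow_support[OF F x(2)] by (intro sum.cong) auto
    also have "\<dots> = (\<Sum>h\<in>F \<times> UNIV. if inc G h = v then real_of_int (\<tau> h) * x (fst h) else 0)"
      using fin by (intro sum.inter_filter) auto
    also have "\<dots> = (\<Sum>e\<in>F. \<Sum>b\<in>UNIV. if inc G (e, b) = v then real_of_int (\<tau> (e, b)) * x e else 0)"
      unfolding sum.cartesian_product by (intro sum.cong) auto
    also have "\<dots> = (\<Sum>e\<in>F. ?A v e * x e)"
      unfolding sum_distrib_right by (intro sum.cong) auto
    finally show ?thesis using zero True by simp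
  next
    case False
    then have "{h. fst h \<in> F \<and> inc G h = v} = {}" by force
    then show ?thesis unfolding netflow_support[OF F x(2)] by (simp only: sum.empty)
  qed
  with indep x show False unfolding independent_def by blast
qed

text \<open>A single non-integral term with coefficient 1 or -1 cannot be cancelled by integral
  ones. For a loop, \<open>h'\<close> may be the other half of the same edge.\<close>

lemma fractional_degree:
  assumes flow: "is_flow G \<sigma> \<tau> g" and h: "fst h \<in> edges G" "g (fst h) \<notin> \<int>"
  shows "\<exists>h'. fst h' \<in> edges G \<and> g (fst h') \<notin> \<int> \<and> inc G h' = inc G h \<and> h' \<noteq> h"
proof (rule ccontr)
  assume contra: "\<not> ?thesis"
  let ?S = "half_edges_at G (inc G h)"
  have o: "orientation G \<sigma> \<tau>" using flow by (simp add: is_flow_def)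
  have "h \<in> ?S" using h by (simp add: half_edges_at_def)
  then have "netflow G \<tau> g (inc G h) =
      real_of_int (\<tau> h) * g (fst h) + (\<Sum>h'\<in>?S - {h}. real_of_int (\<tau> h') * g (fst h'))"
    unfolding netflow_def by (intro sum.remove finite_half_edges_at)
  moreover have "netflow G \<tau> g (inc G h) = 0"
    using flow h(1) inc_verts' by (simp add: is_flow_netflow)
  moreover have "(\<Sum>h'\<in>?S - {h}. real_of_int (\<tau> h') * g (fst h')) \<in> \<int>"
    using contra by (intro Ints_sum Ints_mult) (auto simp: half_edges_at_def)
  ultimately have "real_of_int (\<tau> h) * g (fst h) \<in> \<int>"
    by (metis Ints_add_eq_0 add.commute)
  then show False
    using orientation_sign[OF o h(1)] h(2) by auto
qed

text \<open>An independent set has at most as many edges as vertices, and every vertex meets the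
  fractional edges at least twice, so equality holds everywhere.\<close>

lemma fractional_two_regular:
  assumes flow: "is_flow G \<sigma> \<tau> g" and F: "F = {e \<in> edges G. g e \<notin> \<int>}" and indep: "independent \<tau> F"
  shows "two_regular G \<sigma> F"
proof
  show "F \<subseteq> edges G" by (auto simp: F)
  fix h :: "'e half_edge" assume h: "fst h \<in> F"
  let ?H = "F \<times> (UNIV :: bool set)"
  let ?D = "\<lambda>v. {h\<in>?H. inc G h = v}"
  have fin: "finite ?H" using finite_edges by (simp add: F)
  have ge: "2 \<le> card (?D v)" if "v \<in> inc G ` ?H" for v
  proof -
    obtain h1 where h1: "fst h1 \<in> F" "inc G h1 = v" using \<open>v \<in> inc G ` ?H\<close> by auto
    then obtain h2 where "fst h2 \<in> F" "inc G h2 = v" "h2 \<noteq> h1"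
      using fractional_degree[OF flow, of h1] by (auto simp: F)
    with h1 have "{h1, h2} \<subseteq> ?D v" "card {h1, h2} = 2" by (auto simp: mem_Times_iff)
    then show ?thesis using card_mono[of "?D v" "{h1, h2}"] fin by simp
  qed
  \<comment> \<open>Double counting of half-edges: the degrees sum to \<open>2 * card F\<close>, at
    most twice the number of endpoints, so no degree can exceed two.\<close>
  have "(\<Sum>v\<in>inc G ` ?H. card (?D v)) = (\<Sum>h\<in>?H. 1)"
    using sum.image_gen[OF fin, of "\<lambda>_. 1 :: nat" "inc G"] by simp
  also have "\<dots> = 2 * card F" by (simp add: card_cartesian_product)
  also have "\<dots> \<le> (\<Sum>v\<in>inc G ` ?H. 2)"
    using card_independent_le[OF \<open>F \<subseteq> edges G\<close> indep] by simp
  finally have le: "(\<Sum>v\<in>inc G ` ?H. card (?D v)) \<le> (\<Sum>v\<in>inc G ` ?H. 2)" .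
  have v: "inc G h \<in> inc G ` ?H" using h by (auto simp: mem_Times_iff)
  have "card (?D (inc G h)) = 2"
  proof (rule ccontr)
    assume "card (?D (inc G h)) \<noteq> 2"
    with ge[OF v] have "2 < card (?D (inc G h))" by simp
    with v have "\<exists>v\<in>inc G ` ?H. 2 < card (?D v)" by blast
    then have "(\<Sum>v\<in>inc G ` ?H. 2) < (\<Sum>v\<in>inc G ` ?H. card (?D v))"
      using fin ge by (intro sum_strict_mono_ex1) blast+
    with le show False by simp
  qed
  then obtain h1 h2 where h12: "?D (inc G h) = {h1, h2}" "h1 \<noteq> h2"
    by (meson card_2_iff)
  have "h \<in> ?D (inc G h)" using h by (simp add: mem_Times_iff)
  then have "h = h1 \<or> h = h2" unfolding h12 by simp
  moreover define h' where "h' = (if h = h1 then h2 else h1)"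
  ultimately have h': "?D (inc G h) = {h, h'}" "h' \<noteq> h"
    unfolding h12 using h12(2) by auto
  show "\<exists>!h'. fst h' \<in> F \<and> inc G h' = inc G h \<and> h' \<noteq> h"
  proof
    have "h' \<in> ?D (inc G h)" unfolding h'(1) by simp
    then show "fst h' \<in> F \<and> inc G h' = inc G h \<and> h' \<noteq> h" using h'(2) by auto
    fix h'' assume "fst h'' \<in> F \<and> inc G h'' = inc G h \<and> h'' \<noteq> h"
    then have "h'' \<in> ?D (inc G h)" "h'' \<noteq> h" by (simp_all add: mem_Times_iff)
    then show "h'' = h'" unfolding h'(1) by simp
  qed
qed

end

text \<open>Modulo 1, \<open>s * a\<close> is the negative of \<open>t * b\<close>. Since
  \<open>frac - 1 / 2\<close> has period 1 and is odd off the integers, it turns this congruence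
  into an equality.\<close>

lemma frac_cancel:
  fixes a b :: real
  assumes "a \<notin> \<int>" "b \<notin> \<int>" "s = 1 \<or> s = -1" "t = 1 \<or> t = -1" "s * a + t * b \<in> \<int>"
  shows "s * (frac a - 1 / 2) + t * (frac b - 1 / 2) = 0"
proof -
  have sum: "frac x + frac y = 1" if "x + y \<in> \<int>" "x \<notin> \<int>" for x y :: real
  proof -
    have "frac y = frac (- x)" using that frac_add_int_left[of "x + y" "- x"] by simp
    then show ?thesis using that by (simp add: frac_neg)
  qed
  have diff: "frac x = frac y" if "x - y \<in> \<int>" for x y :: real
    using that frac_add_int_left[of "x - y" y] by simp
  consider "s = t" | "s = - t" using assms by auto
  then show ?thesis
  proof cases
    case 1
    with assms have "a + b \<in> \<int>" by (auto simp: algebra_simps dest: Ints_minus)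
    with sum[of a b] assms have "frac a + frac b = 1" by blast
    then have "t * (frac a + frac b - 1) = 0" by simp
    with 1 show ?thesis by (simp add: algebra_simps)
  next
    case 2
    with assms have "a - b \<in> \<int>" by (auto dest: Ints_minus)
    with diff[of a b] 2 show ?thesis by simp
  qed
qed

context two_regular
begin

text \<open>On \<open>F\<close> the odd and periodic function \<open>frac - 1 / 2\<close> of the flow is again a flow.\<close>

lemma fractional_half_integral:
  assumes flow: "is_flow G \<sigma> \<tau> g" and F: "F = {e \<in> edges G. g e \<notin> \<int>}" and indep: "independent \<tau> F"
    and e: "e \<in> F"
  shows "frac (g e) = 1 / 2"
proof -
  define x where "x e = (if e \<in> F then frac (g e) - 1 / 2 else 0)" for e
  have o: "orientation G \<sigma> \<tau>" using flow by (simp add: is_flow_def)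
  have x_F: "\<forall>e. e \<notin> F \<longrightarrow> x e = 0" by (simp add: x_def)
  have "netflow G \<tau> x v = 0" if v: "v \<in> verts G" for v
  proof (cases "\<exists>h. fst h \<in> F \<and> inc G h = v")
    case False
    then have empty: "{h. fst h \<in> F \<and> inc G h = v} = {}" by blast
    show ?thesis unfolding netflow_support[OF F_edges x_F] empty by simp
  next
    case True
    then obtain h where h: "fst h \<in> F" "inc G h = v" by blast
    let ?S = "half_edges_at G v"
    have Fv: "{h. fst h \<in> F \<and> inc G h = v} = {h, mate h}" using half_edges_at_F[OF h(1)] h(2) by simp
    then have sub: "{h, mate h} \<subseteq> ?S" using F_edges by (auto simp: half_edges_at_def)
    have decomp: "netflow G \<tau> g v = (\<Sum>h\<in>?S - {h, mate h}. real_of_int (\<tau> h) * g (fst h)) +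
        (\<Sum>h\<in>{h, mate h}. real_of_int (\<tau> h) * g (fst h))"
      unfolding netflow_def by (rule sum.subset_diff[OF sub finite_half_edges_at])
    have rest: "(\<Sum>h\<in>?S - {h, mate h}. real_of_int (\<tau> h) * g (fst h)) \<in> \<int>"
      unfolding Fv[symmetric] by (intro Ints_sum Ints_mult) (auto simp: half_edges_at_def F)
    have "netflow G \<tau> g v = 0" using flow v by (simp add: is_flow_netflow)
    \<comment> \<open>All terms off \<open>F\<close> are integral and the total is 0, so the two
      terms on \<open>F\<close> add up to an integer.\<close>
    from Ints_add_eq_0[OF rest trans[OF decomp[symmetric] this]]
    have int: "real_of_int (\<tau> h) * g (fst h) + real_of_int (\<tau> (mate h)) * g (fst (mate h)) \<in> \<int>"
      using mate(3)[OF h(1)] by simp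
    have sign: "real_of_int (\<tau> h') = 1 \<or> real_of_int (\<tau> h') = -1" if "fst h' \<in> F" for h'
      using orientation_sign[OF o, of h'] that F_edges by auto
    have "netflow G \<tau> x v = real_of_int (\<tau> h) * x (fst h) + real_of_int (\<tau> (mate h)) * x (fst (mate h))"
      unfolding netflow_support[OF F_edges x_F] Fv using mate(3)[OF h(1)] by simp
    also have "\<dots> = 0"
      using frac_cancel[OF _ _ sign sign int] h(1) mate(1)[OF h(1)] by (simp add: x_def F)
    finally show ?thesis .
  qed
  with indep x_F e have "x e = 0" unfolding independent_def by blast
  with e show ?thesis by (simp add: x_def)
qed

end

section \<open>Parity of negative edges, long barbells and the rounding theorem\<close>

context signed_graph
begin

text \<open>Sum the vertex conditions over \<open>K\<close>. No edge leaves \<open>K\<close>, so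
  each edge enters with both halves: a positive edge cancels and a negative one gives twice its
  value up to sign. These integers sum to 0, hence evenly many are odd, and the odd ones belong to
  the half-integral edges.\<close>

lemma even_fractional_negative_edges:
  assumes flow: "is_flow G \<sigma> \<tau> g" and half: "\<And>e. e \<in> edges G \<Longrightarrow> g e \<notin> \<int> \<Longrightarrow> frac (g e) = 1 / 2"
    and K: "K \<subseteq> verts G" "\<And>e. e \<in> edges G \<Longrightarrow> inc G (e, False) \<in> K \<longleftrightarrow> inc G (e, True) \<in> K"
  shows "even (card {e \<in> edges G. g e \<notin> \<int> \<and> \<sigma> e = -1 \<and> inc G (e, False) \<in> K})"
proof -
  define E where "E = {e \<in> edges G. inc G (e, False) \<in> K}"
  \<comment> \<open>Twice the flow value as an integer; the floor only changes the type, since all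
    values are integral or half-integral.\<close>
  define m where "m e = \<lfloor>2 * g e\<rfloor>" for e
  have fin: "finite E" "finite K" using finite_edges finite_verts K(1) finite_subset by (auto simp: E_def)
  have o: "orientation G \<sigma> \<tau>" using flow by (simp add: is_flow_def)
  have E_iff: "(e, b) \<in> E \<times> UNIV \<longleftrightarrow> e \<in> edges G \<and> inc G (e, b) \<in> K" for e b
    using K(2)[of e] by (cases b) (auto simp: E_def)
  then have E_iff: "h \<in> E \<times> UNIV \<longleftrightarrow> fst h \<in> edges G \<and> inc G h \<in> K" for h
    by (metis prod.collapse)
  have E_at: "half_edges_at G v = {h \<in> E \<times> UNIV. inc G h = v}" if "v \<in> K" for v
    using that unfolding E_iff half_edges_at_def by blast
  have m: "real_of_int (m e) = 2 * g e" "odd (m e) \<longleftrightarrow> g e \<notin> \<int>" if e: "e \<in> edges G" for e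
  proof -
    consider "g e \<in> \<int>" | "frac (g e) = 1 / 2" using half[OF e] by blast
    then have "real_of_int (m e) = 2 * g e \<and> (odd (m e) \<longleftrightarrow> g e \<notin> \<int>)"
    proof cases
      case 1
      then obtain k where "g e = of_int k" by (elim Ints_cases)
      moreover from this have "m e = 2 * k" unfolding m_def by (simp add: floor_eq_iff)
      ultimately show ?thesis by simp
    next
      case 2
      then have eq: "2 * g e = of_int (2 * \<lfloor>g e\<rfloor> + 1)" by (simp add: frac_def)
      then have "m e = 2 * \<lfloor>g e\<rfloor> + 1" unfolding m_def by (simp only: floor_of_int)
      moreover have "g e \<notin> \<int>"
      proof
        assume "g e \<in> \<int>"
        then have "frac (g e) = 0" by (simp only: frac_eq_0_iff)
        with 2 show False by simp
      qed
      ultimately show ?thesis using eq by simp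
    qed
    then show "real_of_int (m e) = 2 * g e" "odd (m e) \<longleftrightarrow> g e \<notin> \<int>" by auto
  qed
  have edge_sum: "(\<Sum>b\<in>UNIV. real_of_int (\<tau> (e, b)) * g e) =
      real_of_int (if \<sigma> e = -1 then \<tau> (e, False) * m e else 0)" if "e \<in> edges G" for e
  proof -
    have "\<tau> (e, True) = - \<sigma> e * \<tau> (e, False)"
      using orientation_opp[OF o, of "(e, False)"] orientation_sign[OF o, of "(e, False)"] that
      by (auto simp: opp_def)
    then show ?thesis
      using signature[OF that] m(1)[OF that] by (auto simp: UNIV_bool algebra_simps)
  qed
  have "0 = (\<Sum>v\<in>K. netflow G \<tau> g v)"
    using flow K(1) by (intro sum.neutral[symmetric]) (auto simp: is_flow_netflow)
  also have "\<dots> = (\<Sum>v\<in>K. \<Sum>h\<in>{h \<in> E \<times> UNIV. inc G h = v}. real_of_int (\<tau> h) * g (fst h))"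
    unfolding netflow_def by (intro sum.cong) (simp_all only: E_at)
  also have "\<dots> = (\<Sum>h\<in>E \<times> UNIV. real_of_int (\<tau> h) * g (fst h))"
  proof (rule sum.group)
    show "finite (E \<times> (UNIV :: bool set))" "finite K" using fin by simp_all
    show "inc G ` (E \<times> UNIV) \<subseteq> K" using E_iff by blast
  qed
  also have "\<dots> = (\<Sum>e\<in>E. \<Sum>b\<in>UNIV. real_of_int (\<tau> (e, b)) * g e)"
    unfolding sum.cartesian_product by (intro sum.cong) auto
  also have "\<dots> = (\<Sum>e\<in>E. real_of_int (if \<sigma> e = -1 then \<tau> (e, False) * m e else 0))"
    using edge_sum by (intro sum.cong) (auto simp: E_def)
  also have "\<dots> = real_of_int (\<Sum>e\<in>E. if \<sigma> e = -1 then \<tau> (e, False) * m e else 0)"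
    by (rule of_int_sum[symmetric])
  finally have "even (\<Sum>e\<in>E. if \<sigma> e = -1 then \<tau> (e, False) * m e else 0)"
    by (metis dvd_0_right of_int_eq_0_iff)
  then have "even (card {e \<in> E. odd (if \<sigma> e = -1 then \<tau> (e, False) * m e else 0)})"
    by (simp only: even_sum_iff[OF fin(1)])
  also have "{e \<in> E. odd (if \<sigma> e = -1 then \<tau> (e, False) * m e else 0)} =
      {e \<in> edges G. g e \<notin> \<int> \<and> \<sigma> e = -1 \<and> inc G (e, False) \<in> K}"
  proof -
    have "odd (\<tau> (e, False) * m e) \<longleftrightarrow> g e \<notin> \<int>" if "e \<in> edges G" for e
      using m(2)[OF that] orientation_sign[OF o, of "(e, False)"] that by auto
    then show ?thesis by (auto simp: E_def)
  qed
  finally show ?thesis .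
qed

lemma joins_verts: "joins G e u v \<Longrightarrow> u \<in> verts G \<and> v \<in> verts G"
  using inc_verts by (auto simp: joins_def)

lemma long_barbellI:
  assumes "is_circuit G vs1 es1" "\<not> balanced \<sigma> es1" "is_circuit G vs2 es2" "\<not> balanced \<sigma> es2"
    "set vs1 \<inter> set vs2 = {}"
    and conn: "(u, v) \<in> {(u, v). \<exists>e. joins G e u v}\<^sup>*" "u \<in> set vs1" "v \<in> set vs2"
  shows "has_long_barbell G \<sigma>"
proof -
  obtain ps where ps: "ps \<noteq> []" "distinct ps" "successively (\<lambda>u v. \<exists>e. joins G e u v) ps"
    "set ps \<inter> set vs1 = {hd ps}" "set ps \<inter> set vs2 = {last ps}"
    using connecting_path[OF conn] by auto
  define pes where "pes = map (\<lambda>i. SOME e. joins G e (ps ! i) (ps ! Suc i)) [0..<length ps - 1]"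
  have edge: "joins G (pes ! i) (ps ! i) (ps ! Suc i)" if "Suc i < length ps" for i
    using that ps(3) someI_ex[of "\<lambda>e. joins G e (ps ! i) (ps ! Suc i)"]
    by (auto simp: pes_def successively_conv_nth)
  \<comment> \<open>The first vertex lies on a circuit, every later one is the end of an edge of the
    path.\<close>
  have "ps ! i \<in> verts G" if "i < length ps" for i
  proof (cases i)
    case 0
    then have "ps ! i \<in> set vs1" using ps by (auto simp: hd_conv_nth)
    then show ?thesis using assms(1) by (auto simp: is_circuit_def)
  next
    case (Suc j)
    then show ?thesis using edge[of j] joins_verts that by blast
  qed
  then have "set ps \<subseteq> verts G" by (auto simp: in_set_conv_nth)
  moreover have "length ps = Suc (length pes)" using ps(1) by (simp add: pes_def)
  ultimately have "is_path G ps pes"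
    using ps(2) edge by (auto simp: is_path_def)
  with assms ps show ?thesis unfolding has_long_barbell_def by blast
qed

text \<open>Independence would make every cycle of \<open>F\<close> unbalanced, and two of them in
  one component of \<open>G\<close> give the forbidden barbell.\<close>

lemma fractional_not_independent:
  assumes nb: "\<not> has_long_barbell G \<sigma>" and flow: "is_flow G \<sigma> \<tau> g"
    and F: "F = {e \<in> edges G. g e \<notin> \<int>}" and e0: "e0 \<in> F"
  shows "\<not> independent \<tau> F"
proof
  assume indep: "independent \<tau> F"
  interpret two_regular G \<sigma> F by (rule fractional_two_regular[OF flow F indep])
  have o: "orientation G \<sigma> \<tau>" using flow by (simp add: is_flow_def)
  have unbalanced: "\<not> balanced \<sigma> (map fst hs)" if "is_cycle hs" for hs
    using balanced_cycle_flow[OF that _ o] indep unfolding independent_def by blast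
  obtain hs where hs: "is_cycle hs" using cycle_through[of "(e0, False)"] e0 by auto
  define R where "R = {(u, v). \<exists>e. joins G e u v}"
  \<comment> \<open>The component of \<open>G\<close>, not of \<open>F\<close>, containing the first
    cycle: a second cycle found in it is joined to the first by a path.\<close>
  define K where "K = {v. (inc G (hs ! 0), v) \<in> R\<^sup>*}"
  have adj: "(inc G h, inc G (opp h)) \<in> R" if "fst h \<in> edges G" for h
    using half_edge_joins[OF that] by (auto simp: R_def)
  have K_adj: "inc G (opp h) \<in> K" if "inc G h \<in> K" "fst h \<in> edges G" for h
    using that adj[of h] unfolding K_def by (simp add: rtrancl.rtrancl_into_rtrancl)
  have nonempty: "length hs > 0" using hs by (auto simp: is_cycle_def)
  then have "hs ! 0 \<in> set hs" by simp
  then have "inc G (hs ! 0) \<in> verts G"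
    using cycle_in_F[OF hs] F_edges inc_verts' by blast
  then have K_verts: "K \<subseteq> verts G"
    using joins_verts by (auto simp: K_def R_def elim: rtranclE)
  have K_closed: "inc G (e, False) \<in> K \<longleftrightarrow> inc G (e, True) \<in> K" if "e \<in> edges G" for e
    using K_adj[of "(e, False)"] K_adj[of "(e, True)"] that by (auto simp: opp_def)
  have hs_K: "inc G (hs ! i) \<in> K" if "i < length hs" for i
    using that
  proof (induction i)
    case 0
    then show ?case by (simp add: K_def)
  next
    case (Suc i)
    then have "fst (hs ! i) \<in> F" using cycle_in_F[OF hs] by simp
    moreover from Suc have "hs ! Suc i = step (hs ! i)" using cycle_nth_Suc[OF hs, of i] by simp
    ultimately show ?case using Suc K_adj[of "hs ! i"] inc_step F_edges by auto
  qed
  let ?N = "{e \<in> edges G. g e \<notin> \<int> \<and> \<sigma> e = -1 \<and> inc G (e, False) \<in> K}"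
  let ?N1 = "{e \<in> set (map fst hs). \<sigma> e = -1}"
  have "even (card ?N)"
    using fractional_half_integral[OF flow F indep]
    by (intro even_fractional_negative_edges[OF flow _ K_verts K_closed]) (auto simp: F)
  moreover have "odd (card ?N1)" using unbalanced[OF hs] by (simp add: balanced_def)
  moreover have "?N1 \<subseteq> ?N"
  proof
    fix e assume e: "e \<in> ?N1"
    then obtain i where i: "i < length hs" "e = fst (hs ! i)" by (auto simp: in_set_conv_nth)
    then have "e \<in> F" using cycle_in_F[OF hs] by simp
    moreover have "inc G (e, False) \<in> K"
      using hs_K[OF i(1)] K_closed[of e] i(2) \<open>e \<in> F\<close> F_edges
      by (cases "hs ! i"; cases "snd (hs ! i)") auto
    ultimately show "e \<in> ?N" using e by (auto simp: F)
  qed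
  \<comment> \<open>An odd set inside an even one is a proper subset; a further element lies on a
    second cycle.\<close>
  moreover from calculation have "?N1 \<noteq> ?N" by metis
  ultimately obtain e2 where "e2 \<in> ?N" "e2 \<notin> ?N1" by blast
  then have e2: "e2 \<in> ?N" "e2 \<notin> set (map fst hs)" by auto
  then have "fst (e2, False) \<in> F" by (simp add: F)
  from cycle_through[OF this] obtain hs2 where hs2: "is_cycle hs2" "(e2, False) \<in> set hs2" by blast
  have "inc G ` set hs \<inter> inc G ` set hs2 = {}"
    using cycles_disjoint[OF hs hs2] e2(2) by simp
  then have "has_long_barbell G \<sigma>"
    using e2(1) hs2(2) \<open>hs ! 0 \<in> set hs\<close>
    by (intro long_barbellI[OF cycle_is_circuit[OF hs] unbalanced[OF hs]
          cycle_is_circuit[OF hs2(1)] unbalanced[OF hs2(1)], of "inc G (hs ! 0)" "inc G (e2, False)"])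
      (auto simp: K_def R_def)
  with nb show False ..
qed

text \<open>Induction on the number of non-integral edges: a nonzero flow \<open>x\<close> on
  \<open>F\<close> leaves the integral edges alone, and pushing along it makes at least one more
  edge integral.\<close>

lemma integer_rounding:
  assumes nb: "\<not> has_long_barbell G \<sigma>" and flow: "is_flow G \<sigma> \<tau> g"
  shows "\<exists>f. is_flow G \<sigma> \<tau> f \<and>
    (\<forall>e\<in>edges G. f e \<in> \<int> \<and> of_int \<lfloor>g e\<rfloor> \<le> f e \<and> f e \<le> of_int \<lceil>g e\<rceil>)"
  using flow
proof (induction "card {e \<in> edges G. g e \<notin> \<int>}" arbitrary: g rule: less_induct)
  case less
  define F where "F = {e \<in> edges G. g e \<notin> \<int>}"
  have fin: "finite F" using finite_edges by (simp add: F_def)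
  show ?case
  proof (cases "F = {}")
    case True
    then show ?thesis using less.prems by (intro exI[of _ g]) (auto simp: F_def)
  next
    case False
    then obtain x where x: "\<forall>e. e \<notin> F \<longrightarrow> x e = 0" "\<forall>v\<in>verts G. netflow G \<tau> x v = 0" "\<exists>e\<in>F. x e \<noteq> 0"
      using fractional_not_independent[OF nb less.prems F_def] unfolding independent_def by blast
    obtain t where t: "\<forall>e\<in>F. of_int \<lfloor>g e\<rfloor> \<le> g e + t * x e \<and> g e + t * x e \<le> of_int \<lceil>g e\<rceil>"
      "\<exists>e\<in>F. g e + t * x e \<in> \<int>"
      using push_to_integer[OF fin x(3), of g] by (auto simp: F_def)
    let ?g = "\<lambda>e. g e + t * x e"
    have flow': "is_flow G \<sigma> \<tau> ?g"
      using less.prems x(2) by (simp add: is_flow_netflow netflow_add_mult)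
    have between: "of_int \<lfloor>g e\<rfloor> \<le> ?g e \<and> ?g e \<le> of_int \<lceil>g e\<rceil>" for e
      using t(1) x(1) by (cases "e \<in> F") auto
    have "{e \<in> edges G. ?g e \<notin> \<int>} \<subset> F"
      using t(2) x(1) by (auto simp: F_def)
    then have "card {e \<in> edges G. ?g e \<notin> \<int>} < card F" using fin by (rule psubset_card_mono[rotated])
    from less.hyps[OF this[unfolded F_def] flow'] obtain f where f: "is_flow G \<sigma> \<tau> f"
      "\<forall>e\<in>edges G. f e \<in> \<int> \<and> of_int \<lfloor>?g e\<rfloor> \<le> f e \<and> f e \<le> of_int \<lceil>?g e\<rceil>" by blast
    have "of_int \<lfloor>g e\<rfloor> \<le> f e \<and> f e \<le> of_int \<lceil>g e\<rceil>" if "e \<in> edges G" for e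
    proof -
      \<comment> \<open>The old bounds are integers, so rounding the new value again does not cross
        them.\<close>
      have "\<lfloor>g e\<rfloor> \<le> \<lfloor>?g e\<rfloor>" "\<lceil>?g e\<rceil> \<le> \<lceil>g e\<rceil>"
        using between[of e] by (simp_all add: le_floor_iff ceiling_le_iff)
      then have "real_of_int \<lfloor>g e\<rfloor> \<le> of_int \<lfloor>?g e\<rfloor>" "real_of_int \<lceil>?g e\<rceil> \<le> of_int \<lceil>g e\<rceil>"
        by simp_all
      with f(2) that show ?thesis by force
    qed
    with f show ?thesis by blast
  qed
qed

end

subsection \<open>Circular flows\<close>

text \<open>Bolzano-Weierstrass, one coordinate at a time: refining the subsequence for a new
  coordinate keeps the earlier limits.\<close>

lemma bounded_family_convergent_subseq:
  fixes f :: "nat \<Rightarrow> 'a \<Rightarrow> real"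
  assumes "finite E" "\<forall>e\<in>E. \<forall>n. \<bar>f n e\<bar> \<le> M"
  shows "\<exists>s l. strict_mono (s :: nat \<Rightarrow> nat) \<and> (\<forall>e\<in>E. (\<lambda>n. f (s n) e) \<longlonglongrightarrow> l e)"
  using assms
proof (induction E rule: finite_induct)
  case empty
  then show ?case using strict_mono_id by blast
next
  case (insert e E)
  then obtain s l where s: "strict_mono (s :: nat \<Rightarrow> nat)"
    and l: "\<forall>e\<in>E. (\<lambda>n. f (s n) e) \<longlonglongrightarrow> l e"
    by auto
  obtain t where t: "strict_mono (t :: nat \<Rightarrow> nat)" "monoseq (\<lambda>n. f (s (t n)) e)"
    using seq_monosub[of "\<lambda>n. f (s n) e"] by blast
  have "Bseq (\<lambda>n. f (s (t n)) e)"
    using insert.prems by (intro BseqI'[of _ M]) auto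
  then obtain c where c: "(\<lambda>n. f (s (t n)) e) \<longlonglongrightarrow> c"
    using Bseq_monoseq_convergent t(2) by (auto simp: convergent_def)
  have "(\<lambda>n. f ((s \<circ> t) n) e') \<longlonglongrightarrow> (l(e := c)) e'" if "e' \<in> insert e E" for e'
  proof (cases "e' = e")
    case True
    with c show ?thesis by simp
  next
    case False
    with that l have "(\<lambda>n. f (s n) e') \<longlonglongrightarrow> l e'" by auto
    from LIMSEQ_subseq_LIMSEQ[OF this t(1)] show ?thesis using False by (simp add: comp_def)
  qed
  with s t(1) show ?case by (metis strict_mono_o)
qed

lemma circular_flow_mono: "circular_flow G \<sigma> r \<tau> f \<Longrightarrow> r \<le> r' \<Longrightarrow> circular_flow G \<sigma> r' \<tau> f"
  by (force simp: circular_flow_def)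

lemma is_flow_scale: "is_flow G \<sigma> \<tau> f \<Longrightarrow> is_flow G \<sigma> \<tau> (\<lambda>e. c * f e)"
proof -
  have "netflow G \<tau> (\<lambda>e. c * f e) v = c * netflow G \<tau> f v" for v
    by (simp add: netflow_def sum_distrib_left algebra_simps)
  then show "is_flow G \<sigma> \<tau> f \<Longrightarrow> is_flow G \<sigma> \<tau> (\<lambda>e. c * f e)"
    by (simp add: is_flow_netflow)
qed

text \<open>Rounding crosses none of the integers \<open>a\<close>, \<open>b\<close>,
  \<open>- a\<close>, \<open>- b\<close>.\<close>

lemma abs_between_floor_ceiling:
  fixes x y :: real and a b :: int
  assumes "of_int a \<le> \<bar>x\<bar>" "\<bar>x\<bar> \<le> of_int b" "0 \<le> a" "of_int \<lfloor>x\<rfloor> \<le> y" "y \<le> of_int \<lceil>x\<rceil>"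
  shows "of_int a \<le> \<bar>y\<bar> \<and> \<bar>y\<bar> \<le> of_int b"
proof (cases "0 \<le> x")
  case True
  with assms have "a \<le> \<lfloor>x\<rfloor>" "\<lceil>x\<rceil> \<le> b" by (simp_all add: le_floor_iff ceiling_le_iff)
  then have "real_of_int a \<le> of_int \<lfloor>x\<rfloor>" "real_of_int \<lceil>x\<rceil> \<le> of_int b" by simp_all
  with assms show ?thesis by linarith
next
  case False
  with assms have "\<lceil>x\<rceil> \<le> - a" "- b \<le> \<lfloor>x\<rfloor>" by (simp_all add: le_floor_iff ceiling_le_iff)
  then have "real_of_int \<lceil>x\<rceil> \<le> of_int (- a)" "real_of_int (- b) \<le> of_int \<lfloor>x\<rfloor>"
    by (simp_all only: of_int_le_iff)
  with assms show ?thesis by simp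
qed

section \<open>Membership in \<open>G1\<close> and the two flow numbers\<close>

context signed_graph
begin

text \<open>Two orientations agree up to sign on each whole edge, both having product
  \<open>- \<sigma> e\<close> there, so changing the sign of \<open>f\<close> where they differ at
  the half-edge \<open>False\<close> compensates at both halves.\<close>

lemma reorient:
  assumes flow: "is_flow G \<sigma> \<tau> f" and o: "orientation G \<sigma> \<tau>'"
  shows "\<exists>f'. is_flow G \<sigma> \<tau>' f' \<and> (\<forall>e\<in>edges G. \<bar>f' e\<bar> = \<bar>f e\<bar>)"
proof -
  define f' where "f' e = of_int (\<tau>' (e, False) * \<tau> (e, False)) * f e" for e
  have o': "orientation G \<sigma> \<tau>" using flow by (simp add: is_flow_def)
  have eq: "\<tau>' h * (\<tau>' (fst h, False) * \<tau> (fst h, False)) = \<tau> h" if "fst h \<in> edges G" for h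
  proof -
    consider "h = (fst h, False)" | "h = opp (fst h, False)"
      by (cases h) (auto simp: opp_def)
    then show ?thesis
    proof cases
      case 1
      then show ?thesis using orientation_sign[OF o that] by auto
    next
      case 2
      have "\<tau>' h * \<tau>' (fst h, False) = - \<sigma> (fst h)" "\<tau> h * \<tau> (fst h, False) = - \<sigma> (fst h)"
        using orientation_opp[OF o, of "(fst h, False)"] orientation_opp[OF o', of "(fst h, False)"]
          that 2 by simp_all
      then have "\<tau>' h * (\<tau>' (fst h, False) * \<tau> (fst h, False)) =
          \<tau> h * (\<tau> (fst h, False) * \<tau> (fst h, False))"
        by (simp flip: mult.assoc)
      then show ?thesis using orientation_sign[OF o', of "(fst h, False)"] that by auto
    qed
  qed
  have "netflow G \<tau>' f' v = netflow G \<tau> f v" for v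
    unfolding netflow_def
  proof (rule sum.cong[OF refl])
    fix h assume "h \<in> half_edges_at G v"
    then have "real_of_int (\<tau>' h * (\<tau>' (fst h, False) * \<tau> (fst h, False))) = of_int (\<tau> h)"
      using eq by (simp add: half_edges_at_def)
    then show "real_of_int (\<tau>' h) * f' (fst h) = of_int (\<tau> h) * f (fst h)"
      by (simp add: f'_def flip: mult.assoc)
  qed
  then have "is_flow G \<sigma> \<tau>' f'" using flow o by (simp add: is_flow_netflow)
  moreover have "\<bar>f' e\<bar> = \<bar>f e\<bar>" if "e \<in> edges G" for e
    using orientation_sign[OF o, of "(e, False)"] orientation_sign[OF o', of "(e, False)"] that
    by (auto simp: f'_def)
  ultimately show ?thesis by blast
qed

lemma integer_flow_between:
  assumes nb: "\<not> has_long_barbell G \<sigma>" and flow: "is_flow G \<sigma> \<tau> g" and a: "0 \<le> a"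
    and bounds: "\<And>e. e \<in> edges G \<Longrightarrow> of_int a \<le> \<bar>g e\<bar> \<and> \<bar>g e\<bar> \<le> of_int b"
  shows "\<exists>f. is_flow G \<sigma> \<tau> f \<and>
    (\<forall>e\<in>edges G. f e \<in> \<int> \<and> of_int a \<le> \<bar>f e\<bar> \<and> \<bar>f e\<bar> \<le> of_int b)"
  using integer_rounding[OF nb flow] abs_between_floor_ceiling[OF _ _ a] bounds by metis

text \<open>Multiplication by \<open>q\<close> turns the bounds into the integers \<open>q\<close>
  and \<open>p - q\<close>, which rounding respects; division by \<open>q\<close> then gives values
  on the grid of width \<open>1 / q\<close>.\<close>

lemma no_long_barbell_G1:
  assumes nb: "\<not> has_long_barbell G \<sigma>"
  shows "(G, \<sigma>) \<in> G1"
  unfolding G1_def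
proof (intro CollectI case_prodI allI impI)
  fix p q :: nat
  assume q: "0 < q" and "\<exists>\<tau> f. circular_flow G \<sigma> (real p / real q) \<tau> f"
  then obtain \<tau> f where f: "circular_flow G \<sigma> (real p / real q) \<tau> f" by blast
  let ?a = "int q" and ?b = "int p - int q"
  have "of_int ?a \<le> \<bar>real q * f e\<bar> \<and> \<bar>real q * f e\<bar> \<le> of_int ?b" if "e \<in> edges G" for e
    using f that q by (auto simp: circular_flow_def abs_mult field_simps)
  moreover have "is_flow G \<sigma> \<tau> (\<lambda>e. real q * f e)"
    using f is_flow_scale by (auto simp: circular_flow_def)
  ultimately obtain g where g: "is_flow G \<sigma> \<tau> g"
    "\<forall>e\<in>edges G. g e \<in> \<int> \<and> of_int ?a \<le> \<bar>g e\<bar> \<and> \<bar>g e\<bar> \<le> of_int ?b"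
    using integer_flow_between[OF nb, of \<tau> "\<lambda>e. real q * f e" ?a ?b] by auto
  define f' where "f' e = 1 / real q * g e" for e
  have flow: "is_flow G \<sigma> \<tau> f'" unfolding f'_def by (rule is_flow_scale[OF g(1)])
  have in_grid: "\<bar>f' e\<bar> \<in> {1 + real i / real q | i :: nat. 1 + real i / real q \<le> real p / real q - 1}"
    if "e \<in> edges G" for e
  proof -
    have "g e \<in> \<int>" "real q \<le> \<bar>g e\<bar>" "\<bar>g e\<bar> \<le> real p - real q"
      using g(2) that by auto
    then obtain k where k: "g e = of_int k" by (elim Ints_cases)
    \<comment> \<open>The grid index; \<open>nat\<close> loses nothing, since
      \<open>\<bar>k\<bar>\<close> is at least \<open>q\<close>.\<close>
    define i where "i = nat (\<bar>k\<bar> - int q)"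
    have "real q \<le> of_int \<bar>k\<bar>" using k \<open>real q \<le> \<bar>g e\<bar>\<close> by simp
    then have "int q \<le> \<bar>k\<bar>" by linarith
    then have i: "\<bar>g e\<bar> = real q + real i" using k by (simp add: i_def)
    then have "\<bar>f' e\<bar> = 1 + real i / real q" using q by (simp add: f'_def abs_mult field_simps)
    moreover have "1 + real i / real q \<le> real p / real q - 1"
      using divide_right_mono[of "real i + 2 * real q" "real p" "real q"] i \<open>\<bar>g e\<bar> \<le> real p - real q\<close> q
      by (simp add: add_divide_distrib)
    ultimately show ?thesis by blast
  qed
  have "1 \<le> \<bar>f' e\<bar> \<and> \<bar>f' e\<bar> \<le> real p / real q - 1" if "e \<in> edges G" for e
    using in_grid[OF that] by auto
  with flow f have "circular_flow G \<sigma> (real p / real q) \<tau> f'" by (simp add: circular_flow_def)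
  with in_grid show "\<exists>\<tau> f. circular_flow G \<sigma> (real p / real q) \<tau> f \<and>
        (\<forall>e \<in> edges G. \<bar>f e\<bar> \<in>
           {1 + real i / real q | i :: nat. 1 + real i / real q \<le> real p / real q - 1})"
    by blast
qed

text \<open>Compactness: flows for values of \<open>r\<close> tending to the infimum, rewritten for
  one common orientation so that they can be compared, have a convergent subsequence, and all
  conditions survive the limit.\<close>

lemma Phi_c_attained:
  assumes ex: "\<exists>r \<tau> f. circular_flow G \<sigma> r \<tau> f"
  shows "\<exists>\<tau> f. circular_flow G \<sigma> (Phi_c G \<sigma>) \<tau> f"
proof -
  let ?S = "{r. \<exists>\<tau> f. circular_flow G \<sigma> r \<tau> f}"
  let ?c = "Phi_c G \<sigma>"
  have c: "?c = Inf ?S" by (simp add: Phi_c_def)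
  have ne: "?S \<noteq> {}" using ex by blast
  have "2 \<le> ?c" unfolding c by (rule cInf_greatest[OF ne]) (auto simp: circular_flow_def)
  obtain \<tau> where o: "orientation G \<sigma> \<tau>" using ex by (auto simp: circular_flow_def is_flow_def)
  have "\<exists>f. circular_flow G \<sigma> (?c + inverse (real (Suc n))) \<tau> f" for n
  proof -
    have "Inf ?S < ?c + inverse (real (Suc n))" unfolding c by simp
    then obtain r \<tau>' f where r: "r < ?c + inverse (real (Suc n))" "circular_flow G \<sigma> r \<tau>' f"
      using cInf_lessD[OF ne] by blast
    then have f: "circular_flow G \<sigma> (?c + inverse (real (Suc n))) \<tau>' f"
      using circular_flow_mono by (metis less_imp_le)
    then have "is_flow G \<sigma> \<tau>' f" by (simp add: circular_flow_def)
    from reorient[OF this o]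
    obtain f' where "is_flow G \<sigma> \<tau> f'" "\<forall>e\<in>edges G. \<bar>f' e\<bar> = \<bar>f e\<bar>" by blast
    with f show ?thesis by (auto simp: circular_flow_def)
  qed
  then obtain f where f: "\<And>n. circular_flow G \<sigma> (?c + inverse (real (Suc n))) \<tau> (f n)" by metis
  \<comment> \<open>A bound uniform in \<open>n\<close>, because the excess over the infimum is at
    most 1.\<close>
  have "\<bar>f n e\<bar> \<le> ?c" if "e \<in> edges G" for n e
  proof -
    have "\<bar>f n e\<bar> \<le> ?c + inverse (real (Suc n)) - 1" using f that by (simp add: circular_flow_def)
    moreover have "inverse (real (Suc n)) \<le> 1" by (simp add: field_simps)
    ultimately show ?thesis by linarith
  qed
  then obtain s l where s: "strict_mono (s :: nat \<Rightarrow> nat)"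
    and l: "\<forall>e\<in>edges G. (\<lambda>n. f (s n) e) \<longlonglongrightarrow> l e"
    using bounded_family_convergent_subseq[OF finite_edges, of f ?c] by blast
  have "netflow G \<tau> l v = 0" if v: "v \<in> verts G" for v
  proof (rule LIMSEQ_unique)
    show "(\<lambda>n. netflow G \<tau> (f (s n)) v) \<longlonglongrightarrow> netflow G \<tau> l v"
      unfolding netflow_def using l by (intro tendsto_intros) (auto simp: half_edges_at_def)
    show "(\<lambda>n. netflow G \<tau> (f (s n)) v) \<longlonglongrightarrow> 0"
      using f v by (simp add: circular_flow_def is_flow_netflow)
  qed
  then have "is_flow G \<sigma> \<tau> l" using o by (simp add: is_flow_netflow)
  moreover have "1 \<le> \<bar>l e\<bar> \<and> \<bar>l e\<bar> \<le> ?c - 1" if e: "e \<in> edges G" for e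
  proof
    have lim: "(\<lambda>n. \<bar>f (s n) e\<bar>) \<longlonglongrightarrow> \<bar>l e\<bar>" using l e by (intro tendsto_rabs) auto
    show "1 \<le> \<bar>l e\<bar>"
      using LIMSEQ_le_const[OF lim] f e by (auto simp: circular_flow_def)
    have "(\<lambda>n. inverse (real (Suc (s n)))) \<longlonglongrightarrow> 0"
      using LIMSEQ_subseq_LIMSEQ[OF LIMSEQ_inverse_real_of_nat s] by (simp add: comp_def)
    then have "(\<lambda>n. ?c + inverse (real (Suc (s n))) - 1) \<longlonglongrightarrow> ?c + 0 - 1"
      by (intro tendsto_intros)
    from LIMSEQ_le[OF lim this] show "\<bar>l e\<bar> \<le> ?c - 1"
      using f e by (auto simp: circular_flow_def)
  qed
  ultimately have "circular_flow G \<sigma> ?c \<tau> l" using \<open>2 \<le> ?c\<close> by (simp add: circular_flow_def)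
  then show ?thesis by blast
qed

lemma nowhere_zero_iff_circular:
  assumes nb: "\<not> has_long_barbell G \<sigma>"
  shows "(\<exists>\<tau> f. nowhere_zero_flow G \<sigma> k \<tau> f) \<longleftrightarrow> (\<exists>\<tau> f. circular_flow G \<sigma> (real k) \<tau> f)"
proof
  show "\<exists>\<tau> f. circular_flow G \<sigma> (real k) \<tau> f" if "\<exists>\<tau> f. nowhere_zero_flow G \<sigma> k \<tau> f"
    using that by (auto simp: circular_flow_def nowhere_zero_flow_def)
next
  assume "\<exists>\<tau> f. circular_flow G \<sigma> (real k) \<tau> f"
  then obtain \<tau> g where g: "circular_flow G \<sigma> (real k) \<tau> g" by blast
  then obtain f where "is_flow G \<sigma> \<tau> f"
    "\<forall>e\<in>edges G. f e \<in> \<int> \<and> of_int 1 \<le> \<bar>f e\<bar> \<and> \<bar>f e\<bar> \<le> of_int (int k - 1)"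
    using integer_flow_between[OF nb, of \<tau> g 1 "int k - 1"] by (auto simp: circular_flow_def)
  with g have "nowhere_zero_flow G \<sigma> k \<tau> f" by (auto simp: circular_flow_def nowhere_zero_flow_def)
  then show "\<exists>\<tau> f. nowhere_zero_flow G \<sigma> k \<tau> f" by blast
qed

text \<open>An attained infimum gives a circular flow for its ceiling as well, and this integer
  bound can be rounded to a nowhere-zero flow. Conversely, a nowhere-zero flow is itself
  circular.\<close>

lemma ceiling_Phi_c:
  assumes nb: "\<not> has_long_barbell G \<sigma>" and adm: "flow_admissible G \<sigma>"
  shows "\<lceil>Phi_c G \<sigma>\<rceil> = int (Phi_i G \<sigma>)"
proof -
  let ?P = "\<lambda>k. \<exists>\<tau> f. nowhere_zero_flow G \<sigma> k \<tau> f"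
  let ?S = "{r. \<exists>\<tau> f. circular_flow G \<sigma> r \<tau> f}"
  have "?P (Phi_i G \<sigma>)"
    unfolding Phi_i_def by (rule LeastI_ex) (use adm in \<open>auto simp: flow_admissible_def\<close>)
  then have Phi_i: "real (Phi_i G \<sigma>) \<in> ?S" using nowhere_zero_iff_circular[OF nb] by simp
  then obtain \<tau> f where f: "circular_flow G \<sigma> (Phi_c G \<sigma>) \<tau> f" using Phi_c_attained by auto
  have "bdd_below ?S" by (rule bdd_belowI[of _ 2]) (auto simp: circular_flow_def)
  then have "Phi_c G \<sigma> \<le> real (Phi_i G \<sigma>)"
    unfolding Phi_c_def by (intro cInf_lower Phi_i)
  then have upper: "\<lceil>Phi_c G \<sigma>\<rceil> \<le> int (Phi_i G \<sigma>)" by (simp add: ceiling_le_iff)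
  define k where "k = nat \<lceil>Phi_c G \<sigma>\<rceil>"
  have "2 \<le> Phi_c G \<sigma>" using f by (simp add: circular_flow_def)
  then have k: "int k = \<lceil>Phi_c G \<sigma>\<rceil>" by (simp add: k_def)
  have "Phi_c G \<sigma> \<le> real_of_int \<lceil>Phi_c G \<sigma>\<rceil>" by simp
  then have "Phi_c G \<sigma> \<le> real k" by (simp flip: k)
  with f have "?P k"
    using circular_flow_mono nowhere_zero_iff_circular[OF nb] by blast
  then have "Phi_i G \<sigma> \<le> k" unfolding Phi_i_def by (rule Least_le)
  with k upper show ?thesis by simp
qed

end

theorem theorem5p6:
  fixes G :: "('v, 'e) multigraph" and \<sigma> :: "'e \<Rightarrow> int"
  assumes "signed_graph G \<sigma>"
    and "\<not> has_long_barbell G \<sigma>"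
  shows "(G, \<sigma>) \<in> G1 \<and> (flow_admissible G \<sigma> \<longrightarrow> \<lceil>Phi_c G \<sigma>\<rceil> = int (Phi_i G \<sigma>))"
proof -
  interpret signed_graph G \<sigma> by fact
  show ?thesis using no_long_barbell_G1 ceiling_Phi_c assms(2) by blast
qed

end
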